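(* Let $M$ be a matroid on a finite ground set $E$ with a fixed linear order $<$ on $E$, and let $\Delta_M$ be the augmented external activity complex of $M$. For any linear extension $\prec$ of the external/internal order $\le_{ext/int}$ on the set $\mathcal I(M)$ of independent sets of $M$, listing the facets $F(I)$, $I\in\mathcal I(M)$, in the order $\prec$ is a shelling order of $\Delta_M$.
   Context: Activities: for $S\subseteq E$, an element $e\in E\setminus S$ is externally active with respect to $S$ if there is a circuit $\gamma$ of $M$ with $\gamma\subseteq S\cup\{e\}$ and $e=\max\gamma$, and externally passive otherwise; $\operatorname{EA}(S)$, $\operatorname{EP}(S)$ denote the sets of externally active, resp. passive, elements (so $E\setminus S=\operatorname{EA}(S)\sqcup\operatorname{EP}(S)$). An element $i\in S$ is internally active with respect to $S$ if $i$ is externally active with respect to $E\setminus S$ in the dual matroid $M^\perp$ (with the same order), and internally passive otherwise; the sets are $\operatorname{IA}(S)$, $\operatorname{IP}(S)$. Every independent set $I$ can be written uniquely as $I=B\setminus Y$ with $B$ a basis and $Y\subseteq\operatorname{IA}(B)$; $B$ is called the basis related to $I$, and two independent sets are internally related if they have the same related basis. Order: for independent sets $I,J$, $I\le_{ext/int}J$ iff either $I,J$ are not internally related and $(I\setminus\operatorname{IA}(I))\cup\operatorname{EA}(I)\subseteq(J\setminus\operatorname{IA}(J))\cup\operatorname{EA}(J)$, or $I,J$ are internally related and $I\subseteq J$. This is a partial order on $\mathcal I(M)$. Complex: $\Delta_M$ is the simplicial complex on vertex set $\{x_e,y_e,z_e: e\in E\}$; for $S\subseteq E$ write $x_S=\{x_e:e\in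 S\}$ (similarly $y_S,z_S$) and $x_Sy_Uz_T=x_S\cup y_U\cup z_T$. Its facets are $F(I)=x_{I\cup\operatorname{EP}(I)}\,y_Y\,z_{I\cup\operatorname{EA}(I)}$, one for each independent set $I=B\setminus Y$ ($B$ the related basis, $Y\subseteq\operatorname{IA}(B)$). It is pure. Shelling: an ordering $F_1,\dots,F_s$ of the facets of a pure simplicial complex is a shelling order if for every $i<k$ there exist $j<k$ and a vertex $e\in F_k$ with $F_i\cap F_k\subseteq F_j\cap F_k=F_k\setminus\{e\}$. *)

theory Defs
  imports Main
begin

section \<open>Matroids\<close>

locale matroid =
  fixes E :: "'a set" and Ind :: "'a set set"
  assumes finite_ground: "finite E"
    and indep_ground: "I \<in> Ind \<Longrightarrow> I \<subseteq> E"
    and empty_indep: "{} \<in> Ind"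
    and indep_subset: "J \<in> Ind \<Longrightarrow> I \<subseteq> J \<Longrightarrow> I \<in> Ind"
    and augment: "I \<in> Ind \<Longrightarrow> J \<in> Ind \<Longrightarrow> card I < card J \<Longrightarrow> \<exists>x\<in>J - I. insert x I \<in> Ind"

definition bases :: "'a set set \<Rightarrow> 'a set set" where
  "bases Ind = {B \<in> Ind. \<forall>I\<in>Ind. B \<subseteq> I \<longrightarrow> I = B}"

definition circuits :: "'a set \<Rightarrow> 'a set set \<Rightarrow> 'a set set" where
  "circuits E Ind = {C. C \<subseteq> E \<and> C \<notin> Ind \<and> (\<forall>D. D \<subset> C \<longrightarrow> D \<in> Ind)}"

definition dual_indep :: "'a set \<Rightarrow> 'a set set \<Rightarrow> 'a set set" where
  "dual_indep E Ind = {S. \<exists>B\<in>bases Ind. S \<subseteq> E - B}"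

section \<open>Activities\<close>

text \<open>The linear order on the ground set is the one of the ambient type.\<close>

definition EA :: "'a::linorder set \<Rightarrow> 'a set set \<Rightarrow> 'a set \<Rightarrow> 'a set" where
  "EA E Ind S = {e \<in> E - S. \<exists>C\<in>circuits E Ind. C \<subseteq> insert e S \<and> e = Max C}"

definition EP :: "'a::linorder set \<Rightarrow> 'a set set \<Rightarrow> 'a set \<Rightarrow> 'a set" where
  "EP E Ind S = (E - S) - EA E Ind S"

definition IA :: "'a::linorder set \<Rightarrow> 'a set set \<Rightarrow> 'a set \<Rightarrow> 'a set" where
  "IA E Ind S = {i \<in> S. i \<in> EA E (dual_indep E Ind) (E - S)}"

definition related_basis :: "'a::linorder set \<Rightarrow> 'a set set \<Rightarrow> 'a set \<Rightarrow> 'a set" where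
  "related_basis E Ind I = (THE B. B \<in> bases Ind \<and> (\<exists>Y. Y \<subseteq> IA E Ind B \<and> I = B - Y))"

definition internally_related :: "'a::linorder set \<Rightarrow> 'a set set \<Rightarrow> 'a set \<Rightarrow> 'a set \<Rightarrow> bool" where
  "internally_related E Ind I J \<longleftrightarrow> related_basis E Ind I = related_basis E Ind J"

definition ext_int_le :: "'a::linorder set \<Rightarrow> 'a set set \<Rightarrow> 'a set \<Rightarrow> 'a set \<Rightarrow> bool" where
  "ext_int_le E Ind I J \<longleftrightarrow>
     (\<not> internally_related E Ind I J \<and>
        (I - IA E Ind I) \<union> EA E Ind I \<subseteq> (J - IA E Ind J) \<union> EA E Ind J)
   \<or> (internally_related E Ind I J \<and> I \<subseteq> J)"

definition ext_int_order :: "'a::linorder set \<Rightarrow> 'a set set \<Rightarrow> 'a set rel" where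
  "ext_int_order E Ind = {(I, J). I \<in> Ind \<and> J \<in> Ind \<and> ext_int_le E Ind I J}"

definition linear_extension_on :: "'b set \<Rightarrow> 'b rel \<Rightarrow> 'b rel \<Rightarrow> bool" where
  "linear_extension_on A r R \<longleftrightarrow> linear_order_on A R \<and> r \<subseteq> R"

section \<open>Simplicial complexes and shellings\<close>

definition abstract_complex :: "'v set \<Rightarrow> 'v set set \<Rightarrow> bool" where
  "abstract_complex V \<Delta> \<longleftrightarrow> finite V \<and> \<Delta> \<subseteq> Pow V \<and> (\<forall>F\<in>\<Delta>. \<forall>G. G \<subseteq> F \<longrightarrow> G \<in> \<Delta>)"

definition facets :: "'v set set \<Rightarrow> 'v set set" where
  "facets \<Delta> = {F \<in> \<Delta>. \<forall>G\<in>\<Delta>. F \<subseteq> G \<longrightarrow> G = F}"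

definition pure :: "'v set set \<Rightarrow> bool" where
  "pure \<Delta> \<longleftrightarrow> (\<forall>F\<in>facets \<Delta>. \<forall>G\<in>facets \<Delta>. card F = card G)"

definition shelling_order :: "'v set \<Rightarrow> 'v set set \<Rightarrow> 'v set list \<Rightarrow> bool" where
  "shelling_order V \<Delta> Fs \<longleftrightarrow>
     abstract_complex V \<Delta> \<and> pure \<Delta> \<and> distinct Fs \<and> set Fs = facets \<Delta> \<and>
     (\<forall>k<length Fs. \<forall>i<k. \<exists>j<k. \<exists>e\<in>Fs ! k.
        Fs ! i \<inter> Fs ! k \<subseteq> Fs ! j \<inter> Fs ! k \<and> Fs ! j \<inter> Fs ! k = Fs ! k - {e})"

section \<open>The augmented external activity complex\<close>

datatype 'a vertex = xv 'a | yv 'a | zv 'a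

definition aug_vertices :: "'a set \<Rightarrow> 'a vertex set" where
  "aug_vertices E = xv ` E \<union> yv ` E \<union> zv ` E"

definition aug_facet :: "'a::linorder set \<Rightarrow> 'a set set \<Rightarrow> 'a set \<Rightarrow> 'a vertex set" where
  "aug_facet E Ind I =
     xv ` (I \<union> EP E Ind I) \<union> yv ` (related_basis E Ind I - I) \<union> zv ` (I \<union> EA E Ind I)"

definition aug_complex :: "'a::linorder set \<Rightarrow> 'a set set \<Rightarrow> 'a vertex set set" where
  "aug_complex E Ind = {F. \<exists>I\<in>Ind. F \<subseteq> aug_facet E Ind I}"

end

theory Submission
  imports Defs
begin

text \<open>
  Write cl for the closure operator. Then EA(S) consists of the e outside S with
  e in cl(S_{<e}), and IA(S) of the i in S with i not in cl((S - i) \<union> E_{>i}).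
  The basis B related to I adds to I all y outside cl(I \<union> E_{>y}), and I and B have
  the same externally active and the same internally passive elements. Hence
  F(B - Y) arises from F(B) by replacing z_y by y_y for y in Y, and \<open>\<le>\<close>_{ext/int} compares
  bases by IP \<union> EA, refined by inclusion among internally related sets.

  Let J = B - Y. For every e in J the ridge F(J) - z_e lies in some F(K) with K < J:
  if e is internally active take K = J - e, and if e is internally passive take
  K = (B - e + f) - Y for a suitable exchange partner f. If F(I) contains z_J, then
  IP(B) is disjoint from EP(I), which forces J \<open>\<le>\<close> I. So whenever I precedes J, some z_e with
  e in J is missing from F(I), and the K belonging to e is the facet required for a shelling.
\<close>

section \<open>Closure\<close>

context matroid
begin

text \<open>Phrased by dependent extensions of independent sets, the shape in which the activity
  criteria arrive. For subsets of E it is the usual closure.\<close>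

definition cl :: "'a set \<Rightarrow> 'a set" where
  "cl S = {e \<in> E. e \<in> S \<or> (\<exists>I\<in>Ind. I \<subseteq> S \<and> insert e I \<notin> Ind)}"

lemma finite_indep: "I \<in> Ind \<Longrightarrow> finite I"
  using finite_ground finite_subset indep_ground by blast

lemma extend_indep:
  assumes "J \<in> Ind" "K \<in> Ind" "card J \<le> card K"
  shows "\<exists>J'\<in>Ind. J \<subseteq> J' \<and> J' \<subseteq> J \<union> K \<and> card J' = card K"
  using assms
proof (induction "card K - card J" arbitrary: J)
  case 0
  then show ?case by (intro bexI[of _ J]) auto
next
  case (Suc n)
  then have "card J < card K" by linarith
  then obtain x where x: "x \<in> K - J" "insert x J \<in> Ind"
    using augment Suc.prems by blast
  have c: "card (insert x J) = Suc (card J)"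
    using x finite_indep[OF Suc.prems(1)] by simp
  have "n = card K - card (insert x J)" "card (insert x J) \<le> card K"
    using Suc.hyps(2) c by linarith+
  then obtain J' where "J' \<in> Ind" "insert x J \<subseteq> J'" "J' \<subseteq> insert x J \<union> K" "card J' = card K"
    using Suc.hyps(1)[of "insert x J"] x Suc.prems by blast
  then show ?case using x by (intro bexI[of _ J']) auto
qed

text \<open>The bases of the restriction to S. One-element extensions suffice because
  \<open>Ind\<close> is hereditary.\<close>

definition maximal_indep :: "'a set \<Rightarrow> 'a set \<Rightarrow> bool" where
  "maximal_indep S I \<longleftrightarrow> I \<in> Ind \<and> I \<subseteq> S \<and> (\<forall>s\<in>S - I. insert s I \<notin> Ind)"

lemma extend_to_maximal_indep:
  assumes "I \<in> Ind" "I \<subseteq> S"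
  shows "\<exists>J. maximal_indep S J \<and> I \<subseteq> J"
proof -
  let ?A = "{J \<in> Ind. I \<subseteq> J \<and> J \<subseteq> S}"
  have "finite ?A"
    by (rule finite_subset[of _ "Pow E"]) (use indep_ground finite_ground in auto)
  moreover have "?A \<noteq> {}" using assms by auto
  ultimately obtain J where J: "J \<in> ?A" "\<And>K. K \<in> ?A \<Longrightarrow> J \<subseteq> K \<Longrightarrow> J = K"
    using finite_has_maximal[of ?A] by meson
  have "insert s J \<notin> Ind" if "s \<in> S - J" for s
    using J(1) J(2)[of "insert s J"] that by blast
  then show ?thesis
    unfolding maximal_indep_def using J(1) by (intro exI[of _ J]) blast
qed

lemma maximal_indep_exists: "\<exists>I. maximal_indep S I"
  using extend_to_maximal_indep[OF empty_indep] by blast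

text \<open>A single maximal I decides membership. If some independent J \<subseteq> S had J + e
  dependent while I + e is independent, J could be extended inside J \<union> I + e to |I| + 1
  elements. No independent subset of S is that large, so the extension would contain J + e.\<close>

lemma cl_maximal_indep:
  assumes "maximal_indep S I"
  shows "cl S = {e \<in> E. e \<in> I \<or> insert e I \<notin> Ind}"
proof (intro equalityI subsetI)
  fix e assume e: "e \<in> cl S"
  show "e \<in> {e \<in> E. e \<in> I \<or> insert e I \<notin> Ind}"
  proof (rule ccontr)
    assume "\<not> ?thesis"
    then have eI: "e \<in> E" "e \<notin> I" "insert e I \<in> Ind" using e by (auto simp: cl_def)
    then have "e \<notin> S" using assms by (auto simp: maximal_indep_def)
    then obtain J where J: "J \<in> Ind" "J \<subseteq> S" "insert e J \<notin> Ind"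
      using e by (auto simp: cl_def)
    have I: "I \<in> Ind" "I \<subseteq> S" "\<And>s. s \<in> S - I \<Longrightarrow> insert s I \<notin> Ind"
      using assms by (auto simp: maximal_indep_def)
    have bound: "card K \<le> card I" if K: "K \<in> Ind" "K \<subseteq> S" for K
    proof (rule ccontr)
      assume "\<not> ?thesis"
      then obtain x where "x \<in> K - I" "insert x I \<in> Ind"
        using augment[OF I(1) K(1)] by auto
      then show False using I(3) K by blast
    qed
    have c: "card (insert e I) = Suc (card I)" using eI finite_indep[OF I(1)] by simp
    then obtain J' where J': "J' \<in> Ind" "J \<subseteq> J'" "J' \<subseteq> J \<union> insert e I" "card J' = Suc (card I)"
      using extend_indep[OF J(1) eI(3)] bound[OF J(1,2)] by auto
    have "e \<in> J'"
    proof (rule ccontr)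
      assume "e \<notin> J'"
      then have "J' \<subseteq> S" using J' J I by auto
      then show False using bound J' by fastforce
    qed
    then show False using J J' indep_subset[of J' "insert e J"] by auto
  qed
next
  fix e assume "e \<in> {e \<in> E. e \<in> I \<or> insert e I \<notin> Ind}"
  then show "e \<in> cl S" using assms by (auto simp: maximal_indep_def cl_def)
qed

lemma cl_ground: "cl S \<subseteq> E"
  by (auto simp: cl_def)

lemma cl_superset: "S \<subseteq> E \<Longrightarrow> S \<subseteq> cl S"
  by (auto simp: cl_def)

lemma cl_mono: "S \<subseteq> T \<Longrightarrow> cl S \<subseteq> cl T"
  unfolding cl_def by blast

text \<open>A maximal independent subset of S is still maximal in the closure of S.\<close>

lemma cl_cl: "cl (cl S) = cl S"
proof -
  obtain I where I: "maximal_indep S I" using maximal_indep_exists by blast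
  have "maximal_indep (cl S) I"
    unfolding cl_maximal_indep[OF I] using I indep_ground by (auto simp: maximal_indep_def)
  then show ?thesis using I cl_maximal_indep by simp
qed

lemma cl_least: "S \<subseteq> cl T \<Longrightarrow> cl S \<subseteq> cl T"
  using cl_mono[of S "cl T"] cl_cl by simp

text \<open>For I maximal in S, e being outside \<open>cl S\<close> forces I + f to be maximal in S
  + f. Unless e = f, the set I + e + f is then dependent, and I + e is the witness for the
  conclusion.\<close>

lemma cl_exchange:
  assumes "e \<in> cl (insert f S)" "e \<notin> cl S" "f \<in> E"
  shows "f \<in> cl (insert e S)"
proof -
  obtain I where I: "maximal_indep S I" using maximal_indep_exists by blast
  have e: "e \<in> E" using assms cl_ground by blast
  have eI: "insert e I \<in> Ind" using assms e cl_maximal_indep[OF I] by auto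
  show ?thesis
  proof (cases "insert f I \<in> Ind")
    case False
    then have "maximal_indep (insert f S) I" using I by (auto simp: maximal_indep_def)
    then show ?thesis using assms I cl_maximal_indep by simp
  next
    case True
    have "insert s (insert f I) \<notin> Ind" if "s \<in> S - I" for s
    proof
      assume "insert s (insert f I) \<in> Ind"
      then have "insert s I \<in> Ind" by (rule indep_subset) auto
      then show False using I that by (auto simp: maximal_indep_def)
    qed
    then have "maximal_indep (insert f S) (insert f I)"
      using I True by (auto simp: maximal_indep_def)
    then have "e = f \<or> e \<in> I \<or> insert f (insert e I) \<notin> Ind"
      using assms cl_maximal_indep by (auto simp: insert_commute)
    moreover have "e \<notin> I" using I assms e by (auto simp: maximal_indep_def cl_def)
    ultimately show ?thesis
      using assms(3) eI I unfolding cl_def maximal_indep_def by blast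
  qed
qed

section \<open>Independent sets, bases and spanning sets through closure\<close>

lemma indep_notin_cl:
  assumes "I \<in> Ind" "i \<in> I"
  shows "i \<notin> cl (I - {i})"
proof -
  have "insert i J \<in> Ind" if "J \<subseteq> I - {i}" for J
    using assms(2) that by (intro indep_subset[OF assms(1)]) blast
  then show ?thesis by (auto simp: cl_def)
qed

lemma indepI:
  assumes "I \<subseteq> E" "\<And>i. i \<in> I \<Longrightarrow> i \<notin> cl (I - {i})"
  shows "I \<in> Ind"
proof -
  obtain J where J: "maximal_indep I J" using maximal_indep_exists by blast
  have "I = J"
  proof (rule ccontr)
    assume "I \<noteq> J"
    then obtain i where i: "i \<in> I" "i \<notin> J" using J by (auto simp: maximal_indep_def)
    then have "i \<in> cl (I - {i})" using J assms(1) unfolding maximal_indep_def cl_def by blast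
    then show False using assms(2) i by blast
  qed
  then show ?thesis using J by (simp add: maximal_indep_def)
qed

lemma insert_indep: "I \<in> Ind \<Longrightarrow> e \<in> E \<Longrightarrow> e \<notin> cl I \<Longrightarrow> insert e I \<in> Ind"
  by (auto simp: cl_def)

lemma basis_iff: "B \<in> bases Ind \<longleftrightarrow> B \<in> Ind \<and> cl B = E"
proof
  assume B: "B \<in> bases Ind"
  then have BI: "B \<in> Ind" "B \<subseteq> E" using indep_ground by (auto simp: bases_def)
  have "e \<in> cl B" if e: "e \<in> E" for e
  proof (rule ccontr)
    assume n: "e \<notin> cl B"
    then have "insert e B = B" using B insert_indep[OF BI(1) e] unfolding bases_def by blast
    then show False using n cl_superset[OF BI(2)] by blast
  qed
  then show "B \<in> Ind \<and> cl B = E" using BI cl_ground by blast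
next
  assume B: "B \<in> Ind \<and> cl B = E"
  have "I = B" if I: "I \<in> Ind" "B \<subseteq> I" for I
  proof (rule ccontr)
    assume "I \<noteq> B"
    then obtain i where i: "i \<in> I" "i \<notin> B" using I by blast
    then have "i \<in> cl (I - {i})"
      using B cl_mono[of B "I - {i}"] I indep_ground[OF I(1)] by blast
    then show False using indep_notin_cl[OF I(1) i(1)] by blast
  qed
  then show "B \<in> bases Ind" using B by (auto simp: bases_def)
qed

lemma card_bases_eq:
  assumes "B \<in> bases Ind" "B' \<in> bases Ind"
  shows "card B = card B'"
proof -
  have "\<not> card B < card B'" if B: "B \<in> bases Ind" "B' \<in> bases Ind" for B B'
  proof
    assume "card B < card B'"
    then obtain x where "x \<in> B' - B" "insert x B \<in> Ind"
      using B augment[of B B'] by (auto simp: bases_def)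
    then show False using B by (auto simp: bases_def)
  qed
  then show ?thesis using assms by (metis linorder_neqE_nat)
qed

lemma spanning_contains_basis:
  assumes "S \<subseteq> E"
  shows "cl S = E \<longleftrightarrow> (\<exists>B\<in>bases Ind. B \<subseteq> S)"
proof
  assume S: "cl S = E"
  obtain B where B: "maximal_indep S B" using maximal_indep_exists by blast
  have "cl B = cl S"
    using cl_maximal_indep[OF B] cl_maximal_indep[of B B] B by (auto simp: maximal_indep_def)
  then show "\<exists>B\<in>bases Ind. B \<subseteq> S" using B S basis_iff by (auto simp: maximal_indep_def)
next
  assume "\<exists>B\<in>bases Ind. B \<subseteq> S"
  then show "cl S = E" using basis_iff cl_mono cl_ground by blast
qed

section \<open>The dual matroid\<close>

lemma dual_indep_iff:
  assumes "S \<subseteq> E"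
  shows "S \<in> dual_indep E Ind \<longleftrightarrow> cl (E - S) = E"
proof -
  have "S \<subseteq> E - B \<longleftrightarrow> B \<subseteq> E - S" if "B \<in> bases Ind" for B
    using that assms indep_ground[of B] unfolding bases_def by blast
  then show ?thesis using spanning_contains_basis[OF Diff_subset] by (simp add: dual_indep_def)
qed

lemma dual_dependent_iff:
  assumes "A \<subseteq> E" "i \<in> E - A"
  shows "(\<exists>J\<in>dual_indep E Ind. J \<subseteq> A \<and> insert i J \<notin> dual_indep E Ind)
    \<longleftrightarrow> i \<notin> cl (E - A - {i})"
proof
  assume "\<exists>J\<in>dual_indep E Ind. J \<subseteq> A \<and> insert i J \<notin> dual_indep E Ind"
  then obtain J where J: "J \<in> dual_indep E Ind" "J \<subseteq> A" "insert i J \<notin> dual_indep E Ind"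
    by blast
  have span: "cl (E - J) = E" "cl (E - insert i J) \<noteq> E"
    using J assms dual_indep_iff by auto
  have "i \<notin> cl (E - insert i J)"
  proof
    assume "i \<in> cl (E - insert i J)"
    then have "E - J \<subseteq> cl (E - insert i J)" using cl_superset[of "E - insert i J"] by auto
    then show False using cl_least span cl_ground by blast
  qed
  moreover have "E - A - {i} \<subseteq> E - insert i J" using J by auto
  ultimately show "i \<notin> cl (E - A - {i})" using cl_mono by blast
next
  assume i: "i \<notin> cl (E - A - {i})"
  let ?T = "E - A - {i}"
  obtain I where I: "maximal_indep ?T I" using maximal_indep_exists by blast
  have iI: "insert i I \<in> Ind" using i assms cl_maximal_indep[OF I] by auto
  then obtain B where B: "maximal_indep E B" "insert i I \<subseteq> B"
    using extend_to_maximal_indep[of "insert i I" E] indep_ground by blast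
  have Bind: "B \<in> Ind" "B \<subseteq> E" using B by (auto simp: maximal_indep_def)
  have "cl B = E" using B(1) by (auto simp: maximal_indep_def cl_def)
  then have basis: "B \<in> bases Ind" using Bind basis_iff by blast
  \<comment> \<open>A - B is the witness: B contains i and a maximal independent subset of
    \<open>?T\<close>, so everything outside \<open>insert i (A - B)\<close> lies in the closure of
    B - {i}.\<close>
  have "A - B \<in> dual_indep E Ind" using basis assms unfolding dual_indep_def by blast
  moreover have "insert i (A - B) \<notin> dual_indep E Ind"
  proof
    assume "insert i (A - B) \<in> dual_indep E Ind"
    then have "cl (E - insert i (A - B)) = E"
      using assms dual_indep_iff[of "insert i (A - B)"] by blast
    moreover have "E - insert i (A - B) \<subseteq> cl (B - {i})"
    proof -
      have "I \<subseteq> B - {i}" using B I by (auto simp: maximal_indep_def)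
      moreover have "?T \<subseteq> cl I" using I by (auto simp: maximal_indep_def cl_def)
      ultimately have "?T \<subseteq> cl (B - {i})" using cl_mono by blast
      moreover have "B - {i} \<subseteq> cl (B - {i})" using cl_superset[of "B - {i}"] Bind by blast
      ultimately show ?thesis by blast
    qed
    ultimately have "i \<in> cl (B - {i})" using cl_least assms by blast
    then show False using indep_notin_cl Bind B by blast
  qed
  ultimately show "\<exists>J\<in>dual_indep E Ind. J \<subseteq> A \<and> insert i J \<notin> dual_indep E Ind" by blast
qed

end

section \<open>Activities in terms of closure\<close>

text \<open>Stated for hereditary families so that it applies to the dual before that is known to be a
  matroid.\<close>

lemma EA_hereditary:
  assumes fin: "finite E" and sub: "S \<subseteq> E"
    and empty: "{} \<in> \<I>" and her: "\<And>I J. J \<in> \<I> \<Longrightarrow> I \<subseteq> J \<Longrightarrow> I \<in> \<I>"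
  shows "e \<in> EA E \<I> S \<longleftrightarrow>
    e \<in> E - S \<and> (\<exists>J\<in>\<I>. J \<subseteq> {s \<in> S. s < e} \<and> insert e J \<notin> \<I>)"
proof
  assume "e \<in> EA E \<I> S"
  then obtain C where e: "e \<in> E - S" and C: "C \<in> circuits E \<I>" "C \<subseteq> insert e S" "e = Max C"
    by (auto simp: EA_def)
  have finC: "finite C" using C sub e fin finite_subset by (metis Diff_iff insert_subset)
  have "C \<noteq> {}" using C empty by (auto simp: circuits_def)
  then have eC: "e \<in> C" using C(3) finC by simp
  have "C - {e} \<in> \<I>" using C eC by (auto simp: circuits_def)
  moreover have "C - {e} \<subseteq> {s \<in> S. s < e}" using C finC by (auto simp: order.strict_iff_order)
  moreover have "insert e (C - {e}) \<notin> \<I>" using C eC by (auto simp: circuits_def insert_absorb)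
  ultimately show "e \<in> E - S \<and> (\<exists>J\<in>\<I>. J \<subseteq> {s \<in> S. s < e} \<and> insert e J \<notin> \<I>)"
    using e by blast
next
  assume "e \<in> E - S \<and> (\<exists>J\<in>\<I>. J \<subseteq> {s \<in> S. s < e} \<and> insert e J \<notin> \<I>)"
  then obtain J where e: "e \<in> E - S" and J: "J \<in> \<I>" "J \<subseteq> {s \<in> S. s < e}" "insert e J \<notin> \<I>"
    by blast
  have finJ: "finite J" using J fin sub by (metis (no_types, lifting) finite_subset mem_Collect_eq subset_iff)
  \<comment> \<open>A minimal dependent subset of J + e serves as the circuit. It contains e since J
    is independent, and e is its maximum since J lies below e.\<close>
  let ?A = "{C. C \<subseteq> insert e J \<and> C \<notin> \<I>}"
  have "finite ?A" using finJ by simp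
  moreover have "?A \<noteq> {}" using J by auto
  ultimately obtain C where C: "C \<in> ?A" "\<And>D. D \<in> ?A \<Longrightarrow> D \<subseteq> C \<Longrightarrow> C = D"
    using finite_has_minimal[of ?A] by meson
  have "e \<in> C" using C J her[of J C] by auto
  moreover have "finite C" using C finJ finite_subset by blast
  ultimately have "Max C = e" using C J by (intro Max_eqI) auto
  moreover have CS: "C \<subseteq> insert e S" using C(1) J by auto
  moreover have "D \<in> \<I>" if "D \<subset> C" for D using C(1) C(2)[of D] that by blast
  then have "C \<in> circuits E \<I>" using C(1) CS sub e by (auto simp: circuits_def)
  ultimately show "e \<in> EA E \<I> S" using e by (auto simp: EA_def)
qed

locale ordered_matroid = matroid E Ind
  for E :: "'a::linorder set" and Ind :: "'a set set"
begin

abbreviation EAs where "EAs \<equiv> EA E Ind"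
abbreviation EPs where "EPs \<equiv> EP E Ind"
abbreviation IAs where "IAs \<equiv> IA E Ind"
abbreviation above :: "'a \<Rightarrow> 'a set" where "above e \<equiv> {f \<in> E. e < f}"

lemma EA_iff:
  assumes "S \<subseteq> E"
  shows "e \<in> EAs S \<longleftrightarrow> e \<in> E - S \<and> e \<in> cl {s \<in> S. s < e}"
  using EA_hereditary[OF finite_ground assms empty_indep indep_subset] by (auto simp: cl_def)

text \<open>Activity means that i is in the dual closure of the smaller elements outside S.
  \<open>dual_dependent_iff\<close> passes to the complement of these, which without i is S - {i}
  together with all elements above i.\<close>

lemma IA_iff:
  assumes "S \<subseteq> E"
  shows "i \<in> IAs S \<longleftrightarrow> i \<in> S \<and> i \<notin> cl (S - {i} \<union> above i)"
proof (cases "i \<in> S")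
  case True
  let ?A = "{s \<in> E - S. s < i}"
  have her: "I \<in> dual_indep E Ind" if "J \<in> dual_indep E Ind" "I \<subseteq> J" for I J
    using that unfolding dual_indep_def by blast
  have "cl E = E" using cl_superset[of E] cl_ground by blast
  then have empty: "{} \<in> dual_indep E Ind" using dual_indep_iff[of "{}"] by simp
  have "i \<in> IAs S \<longleftrightarrow> (\<exists>J\<in>dual_indep E Ind. J \<subseteq> ?A \<and> insert i J \<notin> dual_indep E Ind)"
    using EA_hereditary[where e = i, OF finite_ground Diff_subset[of E S] empty her] True assms
    by (auto simp: IA_def)
  also have "\<dots> \<longleftrightarrow> i \<notin> cl (E - ?A - {i})"
    using dual_dependent_iff[of ?A i] True assms by blast
  also have "E - ?A - {i} = S - {i} \<union> above i" using assms by auto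
  finally show ?thesis using True by simp
qed (simp add: IA_def)

section \<open>The related basis\<close>

text \<open>The tool for discarding small elements. Z is added to S from its largest element down;
  if e entered the closure with z, exchange would put z into the closure of e, S and the larger
  elements of Z.\<close>

lemma notin_cl_Un:
  assumes "finite Z" "Z \<subseteq> E" "e \<notin> cl S"
    and "\<And>z. z \<in> Z \<Longrightarrow> z \<notin> cl (insert e S \<union> {z' \<in> Z. z < z'})"
  shows "e \<notin> cl (S \<union> Z)"
  using assms
proof (induction Z rule: finite_linorder_min_induct)
  case empty
  then show ?case by simp
next
  case (insert b A)
  have "e \<notin> cl (S \<union> A)"
  proof (rule insert.IH)
    fix z assume "z \<in> A"
    then show "z \<notin> cl (insert e S \<union> {z' \<in> A. z < z'})"
      using insert.prems(3)[of z] cl_mono[of "insert e S \<union> {z' \<in> A. z < z'}" "insert e S \<union> {z' \<in> insert b A. z < z'}"]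
      by blast
  qed (use insert.prems in auto)
  moreover have "insert e S \<union> {z' \<in> insert b A. b < z'} = insert e (S \<union> A)"
    using insert.hyps by auto
  then have "b \<notin> cl (insert e (S \<union> A))" using insert.prems(3)[of b] by simp
  ultimately show ?case using cl_exchange[of e b "S \<union> A"] insert.prems(1) by auto
qed

text \<open>The greedy completion of I to a basis, scanning E from its largest element down; it
  makes the set Y of the decomposition I = B - Y explicit.\<close>

definition missing :: "'a set \<Rightarrow> 'a set" where
  "missing I = {y \<in> E - I. y \<notin> cl (I \<union> above y)}"

lemma missing_notin_cl:
  assumes "y \<in> missing I" "T \<subseteq> I \<union> above y"
  shows "y \<notin> cl T"
  using assms cl_mono[of T] unfolding missing_def by blast

text \<open>For each z, the elements e, S and the part of Z above z all lie in
  \<open>I \<union> above z\<close>, whose closure omits z.\<close>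

lemma notin_cl_Un_missing:
  assumes "Z \<subseteq> missing I" "e \<notin> cl S" "\<And>z. z \<in> Z \<Longrightarrow> insert e S \<subseteq> I \<union> above z"
  shows "e \<notin> cl (S \<union> Z)"
proof (rule notin_cl_Un)
  show "Z \<subseteq> E" using assms by (auto simp: missing_def)
  then show "finite Z" using finite_ground finite_subset by blast
  fix z assume z: "z \<in> Z"
  show "z \<notin> cl (insert e S \<union> {z' \<in> Z. z < z'})"
    by (rule missing_notin_cl[of _ I]) (use assms z \<open>Z \<subseteq> E\<close> in blast)+
qed (rule assms)

lemma missing_basis:
  assumes "I \<in> Ind"
  shows "I \<union> missing I \<in> bases Ind" (is "?B \<in> _")
proof -
  have BE: "?B \<subseteq> E" using indep_ground assms by (auto simp: missing_def)
  have "b \<notin> cl (?B - {b})" if b: "b \<in> ?B" for b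
  proof (cases "b \<in> I")
    case True
    have "b \<notin> cl ((I - {b}) \<union> missing I)"
      by (rule notin_cl_Un_missing[of _ I]) (use True indep_notin_cl assms in auto)
    moreover have "?B - {b} \<subseteq> (I - {b}) \<union> missing I" by blast
    ultimately show ?thesis using cl_mono by blast
  next
    case False
    then have bm: "b \<in> missing I" using b by blast
    have "b \<notin> cl ((I \<union> above b) \<union> {z \<in> missing I. z < b})"
      by (rule notin_cl_Un_missing[of _ I]) (use bm in \<open>auto simp: missing_def\<close>)
    moreover have "?B - {b} \<subseteq> (I \<union> above b) \<union> {z \<in> missing I. z < b}"
      using BE by auto
    ultimately show ?thesis using cl_mono by blast
  qed
  then have ind: "?B \<in> Ind" using indepI BE by blast
  have "E - cl ?B = {}"
  proof (rule ccontr)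
    \<comment> \<open>All elements above the largest unspanned e are spanned, so e meets the
      condition in \<open>missing\<close> and would belong to \<open>?B\<close> itself.\<close>
    assume ne: "E - cl ?B \<noteq> {}"
    define e where "e = Max (E - cl ?B)"
    have fin: "finite (E - cl ?B)" using finite_ground by blast
    have e: "e \<in> E" "e \<notin> cl ?B" using Max_in[OF fin ne] by (auto simp: e_def)
    have "above e \<subseteq> cl ?B" using Max_ge[OF fin] unfolding e_def by fastforce
    then have "I \<union> above e \<subseteq> cl ?B" using cl_superset[OF BE] by blast
    then have "e \<notin> cl (I \<union> above e)" using e cl_least by blast
    then have "e \<in> ?B" using e by (auto simp: missing_def)
    then show False using e cl_superset[OF BE] by blast
  qed
  then show ?thesis using ind basis_iff cl_ground by blast
qed

text \<open>Missing elements above i are in \<open>above i\<close> anyway, and those below i do not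
  bring i into the closure, by \<open>notin_cl_Un_missing\<close>.\<close>

lemma IA_Int_basis:
  assumes "I \<in> Ind"
  shows "IAs I = I \<inter> IAs (I \<union> missing I)"
proof -
  let ?B = "I \<union> missing I"
  have IE: "I \<subseteq> E" and BE: "?B \<subseteq> E" using indep_ground assms by (auto simp: missing_def)
  have "i \<in> IAs I \<longleftrightarrow> i \<in> IAs ?B" if i: "i \<in> I" for i
  proof
    assume "i \<in> IAs ?B"
    then show "i \<in> IAs I"
      using i cl_mono[of "I - {i} \<union> above i" "?B - {i} \<union> above i"]
      unfolding IA_iff[OF IE] IA_iff[OF BE] by blast
  next
    assume "i \<in> IAs I"
    then have n: "i \<notin> cl (I - {i} \<union> above i)" unfolding IA_iff[OF IE] by blast
    have "i \<notin> cl ((I - {i} \<union> above i) \<union> {z \<in> missing I. z < i})"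
      by (rule notin_cl_Un_missing[of _ I]) (use n i IE in auto)
    moreover have "?B - {i} \<union> above i \<subseteq> (I - {i} \<union> above i) \<union> {z \<in> missing I. z < i}"
      using BE by auto
    ultimately show "i \<in> IAs ?B" using cl_mono i unfolding IA_iff[OF BE] by blast
  qed
  then show ?thesis by (auto simp: IA_def)
qed

lemma missing_subset_IA:
  assumes "I \<in> Ind"
  shows "missing I \<subseteq> IAs (I \<union> missing I)"
proof
  let ?B = "I \<union> missing I"
  have BE: "?B \<subseteq> E" using indep_ground assms by (auto simp: missing_def)
  fix y assume y: "y \<in> missing I"
  have "y \<notin> cl ((I \<union> above y) \<union> {z \<in> missing I. z < y})"
    by (rule notin_cl_Un_missing[of _ I]) (use y in \<open>auto simp: missing_def\<close>)
  moreover have "?B - {y} \<union> above y \<subseteq> (I \<union> above y) \<union> {z \<in> missing I. z < y}"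
    using BE by auto
  ultimately show "y \<in> IAs ?B" using cl_mono y unfolding IA_iff[OF BE] by blast
qed

text \<open>Enlarging I keeps its externally active elements, since they are spanned by I and so not
  missing. No new e arises, since the missing elements below e do not help to span it.\<close>

lemma EA_basis:
  assumes "I \<in> Ind"
  shows "EAs (I \<union> missing I) = EAs I"
proof (intro equalityI subsetI)
  let ?B = "I \<union> missing I"
  have IE: "I \<subseteq> E" and BE: "?B \<subseteq> E" using indep_ground assms by (auto simp: missing_def)
  fix e
  {
    assume "e \<in> EAs I"
    then have e: "e \<in> E - I" "e \<in> cl {s \<in> I. s < e}" unfolding EA_iff[OF IE] by auto
    then have "e \<notin> missing I" using missing_notin_cl[of e I "{s \<in> I. s < e}"] by blast
    then show "e \<in> EAs ?B"
      using e cl_mono[of "{s \<in> I. s < e}" "{s \<in> ?B. s < e}"] unfolding EA_iff[OF BE] by blast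
  next
    assume "e \<in> EAs ?B"
    then have e: "e \<in> E - ?B" "e \<in> cl {s \<in> ?B. s < e}" unfolding EA_iff[OF BE] by auto
    have "e \<in> cl {s \<in> I. s < e}"
    proof (rule ccontr)
      assume n: "e \<notin> cl {s \<in> I. s < e}"
      have "e \<notin> cl ({s \<in> I. s < e} \<union> {z \<in> missing I. z < e})"
        by (rule notin_cl_Un_missing[of _ I]) (use n e in auto)
      moreover have "{s \<in> I. s < e} \<union> {z \<in> missing I. z < e} = {s \<in> ?B. s < e}" by auto
      ultimately show False using e by simp
    qed
    then show "e \<in> EAs I" using e unfolding EA_iff[OF IE] by blast
  }
qed

text \<open>Uniqueness of the decomposition. Elements of Y are missing by the closure form of
  internal activity. An e outside B is not missing: otherwise adding back the elements of Y below e
  would leave e outside the closure of a set containing B.\<close>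

lemma missing_unique:
  assumes "B \<in> bases Ind" "Y \<subseteq> IAs B"
  shows "missing (B - Y) = Y"
proof -
  have BE: "B \<subseteq> E" and B: "cl B = E" using assms indep_ground basis_iff by blast+
  have YB: "Y \<subseteq> B" using assms by (auto simp: IA_def)
  have YIA: "y \<notin> cl (B - {y} \<union> above y)" if "y \<in> Y" for y
    using that assms IA_iff[OF BE] by blast
  have "y \<in> missing (B - Y)" if y: "y \<in> Y" for y
    using YIA[OF y] cl_mono[of "(B - Y) \<union> above y" "B - {y} \<union> above y"] y YB BE
    unfolding missing_def by blast
  moreover have "e \<in> cl ((B - Y) \<union> above e)" if e: "e \<in> E - B" for e
  proof (rule ccontr)
    assume n: "e \<notin> cl ((B - Y) \<union> above e)"
    let ?Z = "{y \<in> Y. y < e}"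
    have ZE: "?Z \<subseteq> E" using YB BE by auto
    have "e \<notin> cl (((B - Y) \<union> above e) \<union> ?Z)"
    proof (rule notin_cl_Un[OF _ ZE n])
      show "finite ?Z" using ZE finite_ground finite_subset by blast
      fix z assume z: "z \<in> ?Z"
      then have "insert e ((B - Y) \<union> above e) \<union> {z' \<in> ?Z. z < z'} \<subseteq> B - {z} \<union> above z"
        using YB e by auto
      then show "z \<notin> cl (insert e ((B - Y) \<union> above e) \<union> {z' \<in> ?Z. z < z'})"
        using YIA[of z] z cl_mono by blast
    qed
    moreover have "B \<subseteq> ((B - Y) \<union> above e) \<union> ?Z" using BE e by (auto simp: not_less le_less)
    ultimately show False using B e cl_mono by blast
  qed
  ultimately show ?thesis by (auto simp: missing_def)
qed

lemma related_basis_eq: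
  assumes "I \<in> Ind"
  shows "related_basis E Ind I = I \<union> missing I"
  unfolding related_basis_def
proof (rule the_equality)
  have "I = I \<union> missing I - missing I" by (auto simp: missing_def)
  then show "I \<union> missing I \<in> bases Ind \<and> (\<exists>Y\<subseteq>IAs (I \<union> missing I). I = I \<union> missing I - Y)"
    using missing_basis[OF assms] missing_subset_IA[OF assms]
    by (intro conjI exI[of _ "missing I"])
next
  fix B assume "B \<in> bases Ind \<and> (\<exists>Y\<subseteq>IAs B. I = B - Y)"
  then obtain Y where "B \<in> bases Ind" "Y \<subseteq> IAs B" "I = B - Y" by blast
  then show "B = I \<union> missing I" using missing_unique[of B Y] by (auto simp: IA_def)
qed

lemma indep_cases:
  assumes "I \<in> Ind"
  obtains B Y where "B \<in> bases Ind" "Y \<subseteq> IAs B" "I = B - Y"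
proof
  show "I = I \<union> missing I - missing I" by (auto simp: missing_def)
qed (use missing_basis missing_subset_IA assms in auto)

section \<open>Independent sets written as a basis minus internally active elements\<close>

context
  fixes B Y
  assumes B: "B \<in> bases Ind" and Y: "Y \<subseteq> IAs B"
begin

lemma diff_IA_indep: "B - Y \<in> Ind"
  using B indep_subset[of B "B - Y"] by (auto simp: bases_def)

lemma diff_IA_Un_missing: "(B - Y) \<union> missing (B - Y) = B"
  using missing_unique[OF B Y] Y by (auto simp: IA_def)

lemma related_basis_diff: "related_basis E Ind (B - Y) = B"
  using related_basis_eq[OF diff_IA_indep] diff_IA_Un_missing by simp

lemma EA_diff: "EAs (B - Y) = EAs B"
  using EA_basis[OF diff_IA_indep] diff_IA_Un_missing by simp

lemma IP_diff: "(B - Y) - IAs (B - Y) = B - IAs B"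
  using IA_Int_basis[OF diff_IA_indep] diff_IA_Un_missing Y by auto

text \<open>I and its externally passive elements together form the complement of
  \<open>EAs B\<close>, so the x-part depends on B alone.\<close>

lemma aug_facet_diff:
  "aug_facet E Ind (B - Y) = xv ` (E - EAs B) \<union> yv ` Y \<union> zv ` ((B - Y) \<union> EAs B)"
proof -
  have "(B - Y) \<union> EPs (B - Y) = E - EAs B"
    using EA_diff indep_ground[OF diff_IA_indep] by (auto simp: EP_def EA_def)
  moreover have "B - (B - Y) = Y" using Y by (auto simp: IA_def)
  ultimately show ?thesis
    unfolding aug_facet_def related_basis_diff EA_diff by simp
qed

end

section \<open>Comparing and exchanging bases\<close>

text \<open>The criterion of Las Vergnas for the external/internal order on bases.\<close>

lemma ext_int_criterion:
  assumes A: "A \<in> bases Ind" and B: "B \<in> bases Ind"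
    and disj: "A - IAs A \<subseteq> B \<union> EAs B"
  shows "(A - IAs A) \<union> EAs A \<subseteq> (B - IAs B) \<union> EAs B"
proof -
  have AE: "A \<subseteq> E" and BE: "B \<subseteq> E" using A B indep_ground by (auto simp: bases_def)
  \<comment> \<open>Both alternatives in \<open>disj\<close> say that a is spanned by the elements
    of B up to a.\<close>
  have IP: "a \<in> cl {b \<in> B. b \<le> a}" if "a \<in> A - IAs A" for a
  proof (cases "a \<in> B")
    case True
    then show ?thesis using cl_superset[of "{b \<in> B. b \<le> a}"] BE by auto
  next
    case False
    then have "a \<in> cl {b \<in> B. b < a}" using that disj EA_iff[OF BE] by blast
    then show ?thesis using cl_mono[of "{b \<in> B. b < a}" "{b \<in> B. b \<le> a}"] by force
  qed
  have "e \<in> EAs B" if e: "e \<in> EAs A" for e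
  proof -
    have eA: "e \<in> E - A" "e \<in> cl {a \<in> A. a < e}" using e EA_iff[OF AE] by auto
    let ?S = "{a \<in> A - IAs A. a < e}" and ?Z = "{a \<in> IAs A. a < e}"
    have ZE: "?Z \<subseteq> E" using AE by (auto simp: IA_def)
    have "e \<in> cl ?S"
    proof (rule ccontr)
      assume n: "e \<notin> cl ?S"
      have "e \<notin> cl (?S \<union> ?Z)"
      proof (rule notin_cl_Un[OF _ ZE n])
        show "finite ?Z" using ZE finite_ground finite_subset by blast
        fix z assume z: "z \<in> ?Z"
        then have "insert e ?S \<union> {z' \<in> ?Z. z < z'} \<subseteq> A - {z} \<union> above z"
          using eA by (auto simp: IA_def)
        then show "z \<notin> cl (insert e ?S \<union> {z' \<in> ?Z. z < z'})"
          using z cl_mono IA_iff[OF AE, of z] by blast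
      qed
      moreover have "?S \<union> ?Z = {a \<in> A. a < e}" by (auto simp: IA_def)
      ultimately show False using eA by simp
    qed
    moreover have "?S \<subseteq> cl {b \<in> B. b < e}"
    proof
      fix a assume a: "a \<in> ?S"
      then show "a \<in> cl {b \<in> B. b < e}"
        using IP[of a] cl_mono[of "{b \<in> B. b \<le> a}" "{b \<in> B. b < e}"] by force
    qed
    ultimately have ec: "e \<in> cl {b \<in> B. b < e}" using cl_least by blast
    have "e \<notin> B"
    proof
      assume "e \<in> B"
      then have "e \<notin> cl (B - {e})" using indep_notin_cl B basis_iff by blast
      then show False using ec cl_mono[of "{b \<in> B. b < e}" "B - {e}"] by blast
    qed
    then show ?thesis using ec eA EA_iff[OF BE] by blast
  qed
  moreover have "e \<notin> IAs B" if e: "e \<in> A - IAs A" for e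
  proof
    assume eB: "e \<in> IAs B"
    have n: "e \<notin> cl (B - {e} \<union> above e)" using eB IA_iff[OF BE] by blast
    have c: "e \<in> cl (A - {e} \<union> above e)" using e IA_iff[OF AE] by blast
    \<comment> \<open>The same splitting with all elements above e adjoined: if e were internally
      active in B, it would be so in A as well.\<close>
    let ?S = "{a \<in> A - IAs A. a < e} \<union> above e" and ?Z = "{a \<in> IAs A. a < e}"
    have "?S \<subseteq> cl (B - {e} \<union> above e)"
    proof
      fix a assume a: "a \<in> ?S"
      show "a \<in> cl (B - {e} \<union> above e)"
      proof (cases "a \<in> above e")
        case True
        then show ?thesis using cl_superset[of "B - {e} \<union> above e"] BE by auto
      next
        case False
        then have "a \<in> A - IAs A" "a < e" using a by auto
        then show ?thesis
          using IP[of a] cl_mono[of "{b \<in> B. b \<le> a}" "B - {e} \<union> above e"] by force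
      qed
    qed
    then have nS: "e \<notin> cl ?S" using n cl_least by blast
    have ZE: "?Z \<subseteq> E" using AE by (auto simp: IA_def)
    have "e \<notin> cl (?S \<union> ?Z)"
    proof (rule notin_cl_Un[OF _ ZE nS])
      show "finite ?Z" using ZE finite_ground finite_subset by blast
      fix z assume z: "z \<in> ?Z"
      then have "insert e ?S \<union> {z' \<in> ?Z. z < z'} \<subseteq> A - {z} \<union> above z"
        using e by (auto simp: IA_def)
      then show "z \<notin> cl (insert e ?S \<union> {z' \<in> ?Z. z < z'})"
        using z cl_mono IA_iff[OF AE, of z] by blast
    qed
    moreover have "A - {e} \<union> above e \<subseteq> ?S \<union> ?Z" using AE by (auto simp: IA_def)
    ultimately show False using c cl_mono by blast
  qed
  ultimately show ?thesis using disj by blast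
qed

lemma basis_exchange:
  assumes B: "B \<in> bases Ind" and e: "e \<in> B" and f: "f \<in> E" "f \<notin> cl (B - {e})"
  shows "insert f (B - {e}) \<in> bases Ind"
proof -
  have Bi: "B \<in> Ind" "cl B = E" "B \<subseteq> E" using B basis_iff indep_ground by auto
  have i: "insert f (B - {e}) \<in> Ind"
    using insert_indep[of "B - {e}" f] f indep_subset[OF Bi(1)] by blast
  have "e \<in> cl (insert f (B - {e}))"
    using cl_exchange[of f e "B - {e}"] f e Bi by (auto simp: insert_absorb)
  then have "B \<subseteq> cl (insert f (B - {e}))"
    using cl_superset[of "insert f (B - {e})"] f Bi by auto
  then have "cl (insert f (B - {e})) = E" using cl_least[of B] Bi cl_ground by blast
  then show ?thesis using i basis_iff by blast
qed

text \<open>Let D be the fundamental cocircuit of e. The partner of e is the least externally active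
  element of D, or the greatest element of D if none is externally active.\<close>

lemma passive_exchange:
  assumes B: "B \<in> bases Ind" and e: "e \<in> B - IAs B"
  obtains f where "f \<in> E - B" "insert f (B - {e}) \<in> bases Ind"
    "IAs B \<subseteq> IAs (insert f (B - {e}))"
    "EAs (insert f (B - {e})) \<subseteq> EAs B" "EAs B \<subseteq> insert f (EAs (insert f (B - {e})))"
    "insert f (B - {e}) - IAs (insert f (B - {e})) \<subseteq> B \<union> EAs B"
proof -
  have BI: "B \<in> Ind" and BE: "B \<subseteq> E" using B basis_iff indep_ground by auto
  have eB: "e \<in> B" and eE: "e \<in> E" using e BE by auto
  have ecl: "e \<notin> cl (B - {e})" using indep_notin_cl[OF BI eB] .
  \<comment> \<open>The complement of the hyperplane \<open>cl (B - {e})\<close> is the fundamental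
    cocircuit of e; e is left out, so that D lies outside B.\<close>
  define D where "D = E - cl (B - {e}) - {e}"
  have D_notin_B: "g \<notin> B" if "g \<in> D" for g
    using that cl_superset[of "B - {e}"] BE unfolding D_def by blast
  \<comment> \<open>If g is active only thanks to e, then e is below g, and exchange puts e into the
    closure of g and part of B - {e}; so g cannot lie in \<open>cl (B - {e})\<close>.\<close>
  have D_EA: "g \<in> D \<and> e < g" if g: "g \<in> EAs B" "g \<notin> cl ({b \<in> B. b < g} - {e})" for g
  proof -
    have g': "g \<in> E - B" "g \<in> cl {b \<in> B. b < g}" using g EA_iff[OF BE] by auto
    have eg: "e < g"
    proof (rule ccontr)
      assume "\<not> e < g"
      then have "{b \<in> B. b < g} - {e} = {b \<in> B. b < g}" by auto
      then show False using g g' by simp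
    qed
    then have "insert e ({b \<in> B. b < g} - {e}) = {b \<in> B. b < g}" using eB by auto
    then have "e \<in> cl (insert g ({b \<in> B. b < g} - {e}))"
      using cl_exchange[of g e "{b \<in> B. b < g} - {e}"] g g' eE by simp
    moreover have "insert g ({b \<in> B. b < g} - {e}) \<subseteq> cl (B - {e})" if "g \<in> cl (B - {e})"
      using that cl_superset[of "B - {e}"] BE by auto
    ultimately have "g \<notin> cl (B - {e})" using ecl cl_least by blast
    then show ?thesis using g' eg eB by (auto simp: D_def)
  qed
  have finD: "finite D" using finite_ground by (auto simp: D_def)
  \<comment> \<open>Below e the new basis stays within B - {e}, so e does not become active.\<close>
  have e_notin_EA: "e \<notin> EAs (insert f (B - {e}))" if f: "f \<in> D" "e < f" for f
  proof
    assume "e \<in> EAs (insert f (B - {e}))"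
    then have "e \<in> cl {b \<in> insert f (B - {e}). b < e}"
      using EA_iff[of "insert f (B - {e})" e] f BE by (auto simp: D_def)
    moreover have "{b \<in> insert f (B - {e}). b < e} \<subseteq> B - {e}" using f by auto
    ultimately show False using ecl cl_mono by blast
  qed
  show ?thesis
  proof (cases "D \<inter> EAs B = {}")
    case False
    \<comment> \<open>Minimality serves the other active g that need e: they lie in D, hence above
      f, and f can replace e in spanning them.\<close>
    define f where "f = Min (D \<inter> EAs B)"
    have f: "f \<in> D" "f \<in> EAs B" and fmin: "\<And>g. g \<in> D \<Longrightarrow> g \<in> EAs B \<Longrightarrow> f \<le> g"
      using Min_in[of "D \<inter> EAs B"] False finD unfolding f_def by auto
    have fE: "f \<in> E - B" "f \<in> cl {b \<in> B. b < f}" using f EA_iff[OF BE] by auto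
    have fcl: "f \<notin> cl (B - {e})" using f by (auto simp: D_def)
    have ef: "e < f"
      using D_EA[OF f(2)] fcl cl_mono[of "{b \<in> B. b < f} - {e}" "B - {e}"] by blast
    let ?B = "insert f (B - {e})"
    have B'E: "?B \<subseteq> E" using BE fE by auto
    show ?thesis
    proof (rule that[OF fE(1)])
      show "?B \<in> bases Ind" using basis_exchange[OF B eB] fE fcl by blast
      show "IAs B \<subseteq> IAs ?B"
      proof
        fix y assume y: "y \<in> IAs B"
        have yB: "y \<in> B" "y \<notin> cl (B - {y} \<union> above y)" using y IA_iff[OF BE] by auto
        have BEy: "B - {y} \<union> above y \<subseteq> cl (B - {y} \<union> above y)" using BE by (intro cl_superset) auto
        \<comment> \<open>Either f lies above y, or f is spanned by elements of B below f, none of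
          which is y.\<close>
        have "f \<in> cl (B - {y} \<union> above y)"
        proof (cases "y < f")
          case True
          then show ?thesis using BEy fE by auto
        next
          case False
          then show ?thesis using fE cl_mono[of "{b \<in> B. b < f}" "B - {y} \<union> above y"] by force
        qed
        then have "?B - {y} \<union> above y \<subseteq> cl (B - {y} \<union> above y)" using BEy by auto
        then have "y \<notin> cl (?B - {y} \<union> above y)" using cl_least yB by blast
        moreover have "y \<noteq> e" using y e by auto
        ultimately show "y \<in> IAs ?B" using yB IA_iff[OF B'E] by blast
      qed
      show "EAs ?B \<subseteq> EAs B"
      proof
        fix g assume g: "g \<in> EAs ?B"
        have g': "g \<in> E - ?B" "g \<in> cl {b \<in> ?B. b < g}" using g EA_iff[OF B'E] by auto
        have gB: "g \<in> E - B" using g g' e_notin_EA[OF f(1) ef] by auto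
        have "{b \<in> ?B. b < g} \<subseteq> cl {b \<in> B. b < g}"
        proof
          fix b assume b: "b \<in> {b \<in> ?B. b < g}"
          show "b \<in> cl {b \<in> B. b < g}"
          proof (cases "b = f")
            case True
            then show ?thesis using b fE cl_mono[of "{b \<in> B. b < f}" "{b \<in> B. b < g}"] by force
          next
            case False
            then show ?thesis using b BE cl_superset[of "{b \<in> B. b < g}"] by auto
          qed
        qed
        then show "g \<in> EAs B" using g' gB cl_least EA_iff[OF BE] by blast
      qed
      show "EAs B \<subseteq> insert f (EAs ?B)"
      proof
        fix g assume g: "g \<in> EAs B"
        have g': "g \<in> E - B" "g \<in> cl {b \<in> B. b < g}" using g EA_iff[OF BE] by auto
        show "g \<in> insert f (EAs ?B)"
        proof (cases "g = f")
          case False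
          have "g \<in> cl {b \<in> ?B. b < g}"
          proof (cases "g \<in> cl ({b \<in> B. b < g} - {e})")
            case True
            then show ?thesis using cl_mono[of "{b \<in> B. b < g} - {e}" "{b \<in> ?B. b < g}"] by blast
          next
            case n: False
            then have "g \<in> D" "e < g" using D_EA g by auto
            then have fg: "f < g" using fmin[of g] g False by force
            let ?S = "{b \<in> B. b < g} - {e}"
            have "insert e ?S = {b \<in> B. b < g}" using \<open>e < g\<close> eB by auto
            moreover have "f \<in> cl {b \<in> B. b < g}"
              using fE fg cl_mono[of "{b \<in> B. b < f}" "{b \<in> B. b < g}"] by force
            moreover have "f \<notin> cl ?S" using fcl cl_mono[of ?S "B - {e}"] by blast
            ultimately have "e \<in> cl (insert f ?S)" using cl_exchange[of f e ?S] eE by simp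
            moreover have sub: "insert f ?S \<subseteq> {b \<in> ?B. b < g}" using fg by auto
            moreover have "{b \<in> ?B. b < g} \<subseteq> cl {b \<in> ?B. b < g}" using B'E by (intro cl_superset) auto
            ultimately have "{b \<in> B. b < g} \<subseteq> cl {b \<in> ?B. b < g}" using cl_mono[OF sub] by auto
            then show ?thesis using g' cl_least by blast
          qed
          then show ?thesis using g' False EA_iff[OF B'E] by blast
        qed simp
      qed
      show "?B - IAs ?B \<subseteq> B \<union> EAs B" using f by blast
    qed
  next
    case True
    \<comment> \<open>Internal passivity of e enters here: it yields an element of D above e, so the
      maximum of D is above e too.\<close>
    have "\<not> above e \<subseteq> cl (B - {e})"
    proof
      assume "above e \<subseteq> cl (B - {e})"
      then have "B - {e} \<union> above e \<subseteq> cl (B - {e})" using cl_superset[of "B - {e}"] BE by auto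
      then show False using e IA_iff[OF BE, of e] ecl cl_least by blast
    qed
    then obtain d where d: "d \<in> D" "e < d" by (auto simp: D_def)
    define f where "f = Max D"
    have f: "f \<in> D" and fmax: "\<And>g. g \<in> D \<Longrightarrow> g \<le> f"
      using Max_in[OF finD] Max_ge[OF finD] d unfolding f_def by auto
    have ef: "e < f" using fmax[OF d(1)] d by order
    have fE: "f \<in> E - B" "f \<notin> cl (B - {e})" using f D_notin_B[OF f] unfolding D_def by blast+
    \<comment> \<open>What the choice of the maximum is for: no element above f is in D.\<close>
    have abv: "above f \<subseteq> cl (B - {e})"
    proof
      fix g assume g: "g \<in> above f"
      then have "g \<notin> D" using fmax[of g] by auto
      then show "g \<in> cl (B - {e})" using g ef by (auto simp: D_def)
    qed
    let ?B = "insert f (B - {e})"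
    have B'E: "?B \<subseteq> E" using BE fE by auto
    show ?thesis
    proof (rule that[OF fE(1)])
      show "?B \<in> bases Ind" using basis_exchange[OF B eB] fE by blast
      show "IAs B \<subseteq> IAs ?B"
      proof
        fix y assume y: "y \<in> IAs B"
        have yB: "y \<in> B" "y \<notin> cl (B - {y} \<union> above y)" using y IA_iff[OF BE] by auto
        have ye: "y \<noteq> e" using y e by auto
        have "y \<notin> cl (?B - {y} \<union> above y)"
        proof
          assume c: "y \<in> cl (?B - {y} \<union> above y)"
          show False
          proof (cases "y < f")
            case True
            then have "?B - {y} \<union> above y \<subseteq> B - {y} \<union> above y" using fE by auto
            then show False using c yB cl_mono by blast
          next
            case False
            then have fy: "f < y" using yB fE by (metis Diff_iff linorder_neqE)
            \<comment> \<open>For y above f, exchange would put f into the closure of elements of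
              \<open>cl (B - {e})\<close>, which omits f.\<close>
            let ?S = "B - {e} - {y} \<union> above y"
            have "?B - {y} \<union> above y = insert f ?S" using yB fE by auto
            moreover have "y \<notin> cl ?S" using yB cl_mono[of ?S "B - {y} \<union> above y"] by blast
            ultimately have "f \<in> cl (insert y ?S)" using c cl_exchange[of y f ?S] fE by simp
            moreover have "insert y ?S \<subseteq> cl (B - {e})"
              using abv fy yB ye cl_superset[of "B - {e}"] BE by auto
            ultimately show False using fE cl_least by blast
          qed
        qed
        then show "y \<in> IAs ?B" using yB ye IA_iff[OF B'E] by blast
      qed
      show "EAs ?B \<subseteq> EAs B"
      proof
        fix g assume g: "g \<in> EAs ?B"
        have g': "g \<in> E - ?B" "g \<in> cl {b \<in> ?B. b < g}" using g EA_iff[OF B'E] by auto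
        have gB: "g \<in> E - B" using g g' e_notin_EA[OF f ef] by auto
        have "g \<in> cl ({b \<in> B. b < g})"
        proof (cases "f < g")
          case False
          then have "{b \<in> ?B. b < g} \<subseteq> {b \<in> B. b < g}" by auto
          then show ?thesis using g' cl_mono by blast
        next
          case True
          \<comment> \<open>Since g is above f, it lies in \<open>cl (B - {e})\<close>, and by
            exchange f is of no help in spanning g.\<close>
          let ?S = "{b \<in> B. b < g} - {e}"
          have "{b \<in> ?B. b < g} = insert f ?S" using True by auto
          moreover have "insert g ?S \<subseteq> cl (B - {e})"
            using abv True gB cl_superset[of "B - {e}"] BE by auto
          then have "f \<notin> cl (insert g ?S)" using fE cl_least by blast
          ultimately have "g \<in> cl ?S" using g' cl_exchange[of g f ?S] fE by auto
          then show ?thesis using cl_mono[of ?S "{b \<in> B. b < g}"] by blast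
        qed
        then show "g \<in> EAs B" using gB EA_iff[OF BE] by blast
      qed
      show "EAs B \<subseteq> insert f (EAs ?B)"
      proof
        fix g assume g: "g \<in> EAs B"
        have g': "g \<in> E - B" using g EA_iff[OF BE] by auto
        have "g \<in> cl ({b \<in> B. b < g} - {e})" using D_EA[OF g] g True by blast
        then have "g \<in> cl {b \<in> ?B. b < g}"
          using cl_mono[of "{b \<in> B. b < g} - {e}" "{b \<in> ?B. b < g}"] by blast
        then show "g \<in> insert f (EAs ?B)" using g' EA_iff[OF B'E] by blast
      qed
      \<comment> \<open>These elements do not span f, so f, the only new element of the basis, is
        internally active.\<close>
      have "?B - {f} \<union> above f \<subseteq> cl (B - {e})"
        using abv cl_superset[of "B - {e}"] BE by auto
      then have "f \<in> IAs ?B" using IA_iff[OF B'E] fE cl_least by blast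
      then show "?B - IAs ?B \<subseteq> B \<union> EAs B" by blast
    qed
  qed
qed

section \<open>Facets and shelling\<close>

lemma aug_facet_subset_vertices:
  assumes "I \<in> Ind"
  shows "aug_facet E Ind I \<subseteq> aug_vertices E"
proof -
  obtain B Y where B: "B \<in> bases Ind" and Y: "Y \<subseteq> IAs B" and I: "I = B - Y"
    using indep_cases assms by blast
  have "B \<subseteq> E" "Y \<subseteq> E" "EAs B \<subseteq> E"
    using B Y indep_ground by (auto simp: bases_def IA_def EA_def)
  then show ?thesis unfolding I aug_facet_diff[OF B Y] aug_vertices_def by auto
qed

text \<open>I is recovered as the set of e with both \<open>xv e\<close> and \<open>zv e\<close> in
  its facet, since I, \<open>EPs I\<close> and \<open>EAs I\<close> are pairwise disjoint.\<close>

lemma aug_facet_inj: "inj_on (aug_facet E Ind) Ind"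
proof (rule inj_on_inverseI)
  fix I assume I: "I \<in> Ind"
  show "{e. xv e \<in> aug_facet E Ind I \<and> zv e \<in> aug_facet E Ind I} = I"
    by (auto simp: aug_facet_def EP_def)
qed

text \<open>In the count over x, y and z the contributions of Y and of the externally active
  elements cancel. Equal cardinality gives purity and shows that no facet lies in another;
  \<open>B0\<close> just names the rank.\<close>

lemma card_aug_facet:
  assumes "I \<in> Ind" and "B0 \<in> bases Ind"
  shows "card (aug_facet E Ind I) = card E + card B0"
proof -
  obtain B Y where B: "B \<in> bases Ind" and Y: "Y \<subseteq> IAs B" and I: "I = B - Y"
    using indep_cases assms by blast
  have EA: "EAs B \<subseteq> E" "EAs B \<inter> B = {}" by (auto simp: EA_def)
  have BE: "B \<subseteq> E" and YB: "Y \<subseteq> B" using B Y indep_ground by (auto simp: bases_def IA_def)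
  have fin: "finite B" "finite Y" "finite (EAs B)"
    using BE YB EA finite_ground finite_subset by metis+
  have "card (aug_facet E Ind I)
      = card (xv ` (E - EAs B)) + card (yv ` Y) + card (zv ` ((B - Y) \<union> EAs B))"
    unfolding I aug_facet_diff[OF B Y] using fin finite_ground
    by (subst card_Un_disjoint; (subst card_Un_disjoint)?) auto
  also have "\<dots> = card (E - EAs B) + card Y + card ((B - Y) \<union> EAs B)"
    by (simp add: card_image inj_on_def)
  also have "card ((B - Y) \<union> EAs B) = card (B - Y) + card (EAs B)"
    using fin EA by (intro card_Un_disjoint) auto
  also have "card (B - Y) = card B - card Y" using fin YB by (simp add: card_Diff_subset)
  also have "card (E - EAs B) = card E - card (EAs B)" using fin EA by (simp add: card_Diff_subset)
  finally show ?thesis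
    using card_bases_eq[OF B assms(2)] card_mono[OF fin(1) YB] card_mono[OF finite_ground EA(1)]
    by simp
qed

lemma facets_aug_complex: "facets (aug_complex E Ind) = aug_facet E Ind ` Ind"
proof (intro equalityI subsetI)
  fix F assume "F \<in> facets (aug_complex E Ind)"
  then show "F \<in> aug_facet E Ind ` Ind" unfolding facets_def aug_complex_def by blast
next
  fix F assume "F \<in> aug_facet E Ind ` Ind"
  then obtain I where I: "I \<in> Ind" "F = aug_facet E Ind I" by blast
  have "G = F" if G: "G \<in> aug_complex E Ind" "F \<subseteq> G" for G
  proof -
    obtain K where K: "K \<in> Ind" "G \<subseteq> aug_facet E Ind K" using G by (auto simp: aug_complex_def)
    have "finite (aug_facet E Ind K)"
      by (rule finite_subset[OF aug_facet_subset_vertices[OF K(1)]])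
        (simp add: aug_vertices_def finite_ground)
    moreover have "card F = card (aug_facet E Ind K)"
      using card_aug_facet missing_basis[OF K(1)] I K by metis
    ultimately have "F = aug_facet E Ind K" using G K by (intro card_subset_eq) auto
    then show ?thesis using G K by blast
  qed
  then show "F \<in> facets (aug_complex E Ind)" using I unfolding facets_def aug_complex_def by blast
qed

text \<open>Passing to the related basis changes neither the externally active nor the internally
  passive elements, so X and Y matter only when the bases agree.\<close>

lemma ext_int_le_diff:
  assumes "A \<in> bases Ind" "X \<subseteq> IAs A" "B \<in> bases Ind" "Y \<subseteq> IAs B"
  shows "ext_int_le E Ind (A - X) (B - Y) \<longleftrightarrow>
    (if A = B then A - X \<subseteq> B - Y else (A - IAs A) \<union> EAs A \<subseteq> (B - IAs B) \<union> EAs B)"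
  using assms by (simp add: ext_int_le_def internally_related_def related_basis_diff IP_diff EA_diff)

text \<open>The local form of the shelling condition: v is not in the facet of I, so the facets of I
  and J meet inside the ridge that J shares with K. The hypothesis holds for every I before J in a
  linear extension, comparable to J or not.\<close>

lemma ridge_exists:
  assumes I: "I \<in> Ind" and J: "J \<in> Ind" and nle: "\<not> ext_int_le E Ind J I"
  obtains K v where "K \<in> Ind" "K \<noteq> J" "ext_int_le E Ind K J" "v \<in> aug_facet E Ind J"
    "v \<notin> aug_facet E Ind I" "aug_facet E Ind K \<inter> aug_facet E Ind J = aug_facet E Ind J - {v}"
proof -
  obtain A X where A: "A \<in> bases Ind" and X: "X \<subseteq> IAs A" and IAX: "I = A - X"
    using indep_cases I by blast
  obtain B Y where B: "B \<in> bases Ind" and Y: "Y \<subseteq> IAs B" and JBY: "J = B - Y"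
    using indep_cases J by blast
  \<comment> \<open>The right side is the z-part of the facet of I, so this provides the vertex
    \<open>zv e\<close>.\<close>
  have "\<not> J \<subseteq> (A - X) \<union> EAs A"
  proof
    assume sub: "J \<subseteq> (A - X) \<union> EAs A"
    have "B - IAs B \<subseteq> A \<union> EAs A" using sub Y unfolding JBY by blast
    then have "(B - IAs B) \<union> EAs B \<subseteq> (A - IAs A) \<union> EAs A" using ext_int_criterion A B by blast
    then have "A = B" using nle ext_int_le_diff[OF B Y A X] IAX JBY by (metis (no_types, lifting))
    then have "J \<subseteq> I" using sub unfolding JBY IAX by (auto simp: EA_def)
    then show False using nle ext_int_le_diff[OF B Y A X] IAX JBY \<open>A = B\<close> by auto
  qed
  then obtain e where e: "e \<in> J" "e \<notin> (A - X) \<union> EAs A" by blast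
  have zJ: "zv e \<in> aug_facet E Ind J" using e by (auto simp: aug_facet_def)
  have zI: "zv e \<notin> aug_facet E Ind I" using e unfolding IAX aug_facet_diff[OF A X] by auto
  show ?thesis
  proof (cases "e \<in> IAs B")
    case True
    then have Y': "insert e Y \<subseteq> IAs B" using Y by blast
    \<comment> \<open>Removing e from J trades \<open>zv e\<close> for \<open>yv e\<close> and
      leaves the rest of the facet alone.\<close>
    let ?K = "B - insert e Y"
    show ?thesis
    proof (rule that[OF diff_IA_indep[OF B] _ _ zJ zI])
      show "?K \<noteq> J" using e by auto
      show "ext_int_le E Ind ?K J" using ext_int_le_diff[OF B Y' B Y] JBY by auto
      have "e \<notin> EAs B" using e JBY by (auto simp: EA_def)
      then show "aug_facet E Ind ?K \<inter> aug_facet E Ind J = aug_facet E Ind J - {zv e}"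
        unfolding JBY aug_facet_diff[OF B Y] aug_facet_diff[OF B Y'] by auto
    qed (rule Y')
  next
    case False
    then have "e \<in> B - IAs B" using e JBY by auto
    then obtain f where f: "f \<in> E - B" and B': "insert f (B - {e}) \<in> bases Ind"
      and IA: "IAs B \<subseteq> IAs (insert f (B - {e}))"
      and EA: "EAs (insert f (B - {e})) \<subseteq> EAs B" "EAs B \<subseteq> insert f (EAs (insert f (B - {e})))"
      and IP: "insert f (B - {e}) - IAs (insert f (B - {e})) \<subseteq> B \<union> EAs B"
      using passive_exchange[OF B] by metis
    \<comment> \<open>K is \<open>?B - Y\<close>. The x-part can only grow because
      \<open>EAs\<close> shrinks, the y-part is unchanged, and the z-part loses e; the one
      externally active element that may be lost is f, which is now in K.\<close>
    let ?B = "insert f (B - {e})"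
    have Y': "Y \<subseteq> IAs ?B" using Y IA by blast
    have eB: "e \<in> B" "e \<notin> Y" using e JBY by auto
    have fY: "f \<notin> Y" using f Y by (auto simp: IA_def)
    have eEA: "e \<notin> EAs ?B" using EA eB by (auto simp: EA_def)
    have ne: "?B \<noteq> B" using f by blast
    show ?thesis
    proof (rule that[OF diff_IA_indep[OF B' Y'] _ _ zJ zI])
      show "?B - Y \<noteq> J" using f fY JBY by auto
      show "ext_int_le E Ind (?B - Y) J"
        using ext_int_le_diff[OF B' Y' B Y] ext_int_criterion[OF B' B IP] ne JBY by simp
      have "zv e \<notin> aug_facet E Ind (?B - Y)"
        unfolding aug_facet_diff[OF B' Y'] using eEA f eB by auto
      moreover have "aug_facet E Ind J - {zv e} \<subseteq> aug_facet E Ind (?B - Y)"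
        unfolding JBY aug_facet_diff[OF B Y] aug_facet_diff[OF B' Y'] using EA f fY by auto
      ultimately show "aug_facet E Ind (?B - Y) \<inter> aug_facet E Ind J = aug_facet E Ind J - {zv e}"
        by blast
    qed
  qed
qed

end

theorem theorem5p7:
  fixes E :: "'a::linorder set" and Ind :: "'a set set"
    and R :: "'a set rel" and Is :: "'a set list"
  assumes "matroid E Ind"
    and "linear_extension_on Ind (ext_int_order E Ind) R"
    and "distinct Is" and "set Is = Ind" and "sorted_wrt (\<lambda>I J. (I, J) \<in> R) Is"
  shows "shelling_order (aug_vertices E) (aug_complex E Ind) (map (aug_facet E Ind) Is)"
proof -
  interpret ordered_matroid E Ind using assms(1) by (simp add: ordered_matroid_def)
  let ?F = "aug_facet E Ind"
  have anti: "antisym R" and ext: "ext_int_order E Ind \<subseteq> R"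
    using assms(2) by (auto simp: linear_extension_on_def linear_order_on_def partial_order_on_def)
  have "abstract_complex (aug_vertices E) (aug_complex E Ind)"
    using finite_ground aug_facet_subset_vertices
    unfolding abstract_complex_def aug_complex_def by (auto simp: aug_vertices_def) blast+
  moreover have "pure (aug_complex E Ind)"
    unfolding pure_def facets_aug_complex using card_aug_facet missing_basis[OF empty_indep] by auto
  moreover have "distinct (map ?F Is)" using assms aug_facet_inj by (simp add: distinct_map)
  moreover have "set (map ?F Is) = facets (aug_complex E Ind)"
    using assms(4) facets_aug_complex by simp
  moreover have "\<exists>j<k. \<exists>v\<in>map ?F Is ! k. map ?F Is ! i \<inter> map ?F Is ! k \<subseteq> map ?F Is ! j \<inter> map ?F Is ! k
      \<and> map ?F Is ! j \<inter> map ?F Is ! k = map ?F Is ! k - {v}"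
    if k: "k < length Is" and i: "i < k" for k i
  proof -
    let ?I = "Is ! i" and ?J = "Is ! k"
    have IJ: "?I \<in> Ind" "?J \<in> Ind" "?I \<noteq> ?J" "(?I, ?J) \<in> R"
      using assms(3-5) k i by (auto simp: nth_eq_iff_index_eq sorted_wrt_iff_nth_less)
    \<comment> \<open>Otherwise \<open>(?J, ?I)\<close> would be in R as well, against
      antisymmetry.\<close>
    have "\<not> ext_int_le E Ind ?J ?I"
      using IJ ext antisymD[OF anti] by (auto simp: ext_int_order_def)
    then obtain K v where K: "K \<in> Ind" "K \<noteq> ?J" "ext_int_le E Ind K ?J"
      and v: "v \<in> ?F ?J" "v \<notin> ?F ?I" "?F K \<inter> ?F ?J = ?F ?J - {v}"
      using ridge_exists[OF IJ(1,2)] by metis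
    obtain j where j: "j < length Is" "Is ! j = K" using K assms(4) by (metis in_set_conv_nth)
    have KJ: "(K, ?J) \<in> R" using K IJ ext by (auto simp: ext_int_order_def)
    have "j < k"
    proof (rule ccontr)
      assume "\<not> j < k"
      then have "k < j" using j K by (metis linorder_neqE_nat)
      then have "(?J, K) \<in> R" using assms(5) j by (auto simp: sorted_wrt_iff_nth_less)
      then show False using KJ antisymD[OF anti] K by blast
    qed
    then show ?thesis using v j k i by (intro exI[of _ j] conjI bexI[of _ v]) auto
  qed
  ultimately show ?thesis unfolding shelling_order_def by simp
qed

end
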